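(* Let $\varphi(s,v)=\vec c(s)+v\,\vec q(s)$ be a spacelike ruled surface in Minkowski 3-space $\mathbb{R}^3_1$ with striction curve $\vec c$ and Frenet frame $\{\vec q,\vec h,\vec a\}$, and let the timelike ruled surface $\varphi^*(s,v)=\vec c^{\,*}(s)+v\,\vec q^{\,*}(s)$, $\vec c^{\,*}(s)=\vec c(s)+R(s)\vec a(s)$, of type $N_-$ or $N_+$, be a Mannheim offset of $\varphi$. Then $\varphi$ is developable if and only if the function $R$ is constant.
   Context: Minkowski 3-space $\mathbb{R}^3_1$ is $\mathbb{R}^3$ with the metric $\langle x,y\rangle=-x_1y_1+x_2y_2+x_3y_3$; a vector $x$ is spacelike if $\langle x,x\rangle>0$ or $x=0$, timelike if $\langle x,x\rangle<0$, null if $\langle x,x\rangle=0$ and $x\ne0$; $\|x\|=\sqrt{|\langle x,x\rangle|}$. All curves and functions are smooth on an open interval. Ruled surface: $\varphi(s,v)=\vec c(s)+v\,\vec q(s)$ with $\langle\vec q,\vec q\rangle=\pm1$ and $d\vec q/ds$ non-null and nonzero everywhere. The base curve $\vec c$ is the striction curve if $\langle d\vec c/ds,d\vec q/ds\rangle=0$; this is assumed for all base curves denoted $\vec c,\vec c^{\,*}$. The surface is developable if its distribution parameter $\delta=\det(\vec c\,',\vec q,\vec q\,')/\langle \vec q\,',\vec q\,'\rangle$ vanishes identically. Frenet frame: $\vec q$ is the ruling, $\vec h=\frac{d\vec q/ds}{\|d\vec q/ds\|}$ the central normal vector, and $\vec a$ the asymptotic normal vector, i.e. the unit vector orthogonal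 to $\vec q$ and $\vec h$ (in the direction of $\pm\,\vec q\times\vec h$). The central normal and the asymptotic normal of a ruling are the lines through the striction point $\vec c(s)$ with directions $\vec h(s)$ and $\vec a(s)$, respectively. Types: the surface is of type $N_-$ if $\vec h$ is spacelike and $\vec q$ is timelike (so $\vec a$ is spacelike); of type $N_+$ if $\vec h$ and $\vec q$ are both spacelike (so $\vec a$ is timelike). Both are timelike surfaces. A spacelike ruled surface here means one of type $N_\times$: $\vec h$ is timelike and $\vec q$ is spacelike (so $\vec a$ is spacelike). Mannheim offset: a ruled surface $\varphi^*$ with striction curve $\vec c^{\,*}$ and Frenet frame $\{\vec q^{\,*},\vec h^*,\vec a^*\}$ is a Mannheim offset of the spacelike ruled surface $\varphi$ if there is a one-to-one correspondence between their rulings (same parameter $s$) such that the asymptotic normal of $\varphi$ is the central normal of $\varphi^*$. With suitable orientations this means $\vec h^*=\vec a$ and $\vec c^{\,*}(s)=\vec c(s)+R(s)\vec a(s)$ for a function $R$. *)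

theory Defs
  imports "HOL-Analysis.Analysis"
begin

section \<open>Minkowski 3-space\<close>

definition mink :: "real^3 \<Rightarrow> real^3 \<Rightarrow> real"  (infix "\<bullet>\<^sub>L" 70) where
  "x \<bullet>\<^sub>L y = - (x $ 1 * y $ 1) + x $ 2 * y $ 2 + x $ 3 * y $ 3"

definition spacelike :: "real^3 \<Rightarrow> bool" where
  "spacelike x \<longleftrightarrow> x \<bullet>\<^sub>L x > 0 \<or> x = 0"

definition timelike :: "real^3 \<Rightarrow> bool" where
  "timelike x \<longleftrightarrow> x \<bullet>\<^sub>L x < 0"

definition null_vector :: "real^3 \<Rightarrow> bool" where
  "null_vector x \<longleftrightarrow> x \<bullet>\<^sub>L x = 0 \<and> x \<noteq> 0"

definition mink_norm :: "real^3 \<Rightarrow> real" where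
  "mink_norm x = sqrt \<bar>x \<bullet>\<^sub>L x\<bar>"

section \<open>Smooth curves\<close>

definition velocity :: "(real \<Rightarrow> 'a::real_normed_vector) \<Rightarrow> real \<Rightarrow> 'a" where
  "velocity f s = vector_derivative f (at s)"

text \<open>Meant for open \<open>I\<close>, so that the two-sided derivatives only depend on the values on \<open>I\<close>.\<close>

definition smooth_curve_on :: "real set \<Rightarrow> (real \<Rightarrow> 'a::real_normed_vector) \<Rightarrow> bool" where
  "smooth_curve_on I f \<longleftrightarrow> (\<forall>n. \<forall>s\<in>I. ((velocity ^^ n) f) differentiable (at s))"

section \<open>Ruled surfaces\<close>

definition striction_curve :: "real set \<Rightarrow> (real \<Rightarrow> real^3) \<Rightarrow> (real \<Rightarrow> real^3) \<Rightarrow> bool" where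
  "striction_curve I c q \<longleftrightarrow> (\<forall>s\<in>I. velocity c s \<bullet>\<^sub>L velocity q s = 0)"

definition ruled_surface ::
  "real set \<Rightarrow> (real \<Rightarrow> real \<Rightarrow> real^3) \<Rightarrow> (real \<Rightarrow> real^3) \<Rightarrow> (real \<Rightarrow> real^3) \<Rightarrow> bool" where
  "ruled_surface I \<phi> c q \<longleftrightarrow>
     (\<forall>s\<in>I. \<forall>v. \<phi> s v = c s + v *\<^sub>R q s) \<and>
     smooth_curve_on I c \<and> smooth_curve_on I q \<and>
     (\<forall>s\<in>I. q s \<bullet>\<^sub>L q s = 1 \<or> q s \<bullet>\<^sub>L q s = -1) \<and>
     (\<forall>s\<in>I. velocity q s \<noteq> 0 \<and> \<not> null_vector (velocity q s))"

definition distribution_parameter :: "(real \<Rightarrow> real^3) \<Rightarrow> (real \<Rightarrow> real^3) \<Rightarrow> real \<Rightarrow> real" where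
  "distribution_parameter c q s =
     det (vector [velocity c s, q s, velocity q s] :: real^3^3) / (velocity q s \<bullet>\<^sub>L velocity q s)"

definition developable :: "real set \<Rightarrow> (real \<Rightarrow> real^3) \<Rightarrow> (real \<Rightarrow> real^3) \<Rightarrow> bool" where
  "developable I c q \<longleftrightarrow> (\<forall>s\<in>I. distribution_parameter c q s = 0)"

text \<open>The conditions determine \<open>a\<close> up to sign, and smoothness makes the sign constant on an
  interval; both orientations are admitted.\<close>

definition frenet_frame ::
  "real set \<Rightarrow> (real \<Rightarrow> real^3) \<Rightarrow> (real \<Rightarrow> real^3) \<Rightarrow> (real \<Rightarrow> real^3) \<Rightarrow> bool" where
  "frenet_frame I q h a \<longleftrightarrow>
     (\<forall>s\<in>I. h s = velocity q s /\<^sub>R mink_norm (velocity q s)) \<and>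
     smooth_curve_on I a \<and>
     (\<forall>s\<in>I. mink_norm (a s) = 1 \<and> a s \<bullet>\<^sub>L q s = 0 \<and> a s \<bullet>\<^sub>L h s = 0)"

definition type_N_minus :: "real set \<Rightarrow> (real \<Rightarrow> real^3) \<Rightarrow> (real \<Rightarrow> real^3) \<Rightarrow> bool" where
  "type_N_minus I q h \<longleftrightarrow> (\<forall>s\<in>I. spacelike (h s) \<and> timelike (q s))"

definition type_N_plus :: "real set \<Rightarrow> (real \<Rightarrow> real^3) \<Rightarrow> (real \<Rightarrow> real^3) \<Rightarrow> bool" where
  "type_N_plus I q h \<longleftrightarrow> (\<forall>s\<in>I. spacelike (h s) \<and> spacelike (q s))"

definition type_N_times :: "real set \<Rightarrow> (real \<Rightarrow> real^3) \<Rightarrow> (real \<Rightarrow> real^3) \<Rightarrow> bool" where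
  "type_N_times I q h \<longleftrightarrow> (\<forall>s\<in>I. timelike (h s) \<and> spacelike (q s))"

section \<open>Mannheim offsets\<close>

definition line_through :: "real^3 \<Rightarrow> real^3 \<Rightarrow> (real^3) set" where
  "line_through p d = range (\<lambda>t. p + t *\<^sub>R d)"

text \<open>Rulings with the same parameter correspond: the asymptotic normal of the first surface
  (\<open>c\<close>, \<open>a\<close>) is, as an unoriented line, the central normal of the second one (\<open>c'\<close>, \<open>h'\<close>).\<close>

definition mannheim_offset ::
  "real set \<Rightarrow> (real \<Rightarrow> real^3) \<Rightarrow> (real \<Rightarrow> real^3) \<Rightarrow> (real \<Rightarrow> real^3) \<Rightarrow> (real \<Rightarrow> real^3) \<Rightarrow> bool" where
  "mannheim_offset I c a c' h' \<longleftrightarrow>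
     (\<forall>s\<in>I. line_through (c s) (a s) = line_through (c' s) (h' s))"

end

theory Submission
  imports Defs
begin

text \<open>
  Write \<open>\<gamma>\<close> and \<open>\<gamma>* = \<gamma> + R a\<close> for the two striction curves. On the offset, the derivative of the
  ruling is a multiple of the central normal, whose line is that of \<open>a\<close>; so the striction condition
  there says that the velocity of \<open>\<gamma>*\<close> is orthogonal to \<open>a\<close>. That velocity is
  \<open>\<gamma>' + R' a + R a'\<close>, and \<open>a'\<close> is orthogonal to the unit field \<open>a\<close>. This leaves
  \<open>\<langle>\<gamma>', a\<rangle> + R' \<langle>a, a\<rangle> = 0\<close>, so \<open>R' = 0\<close> exactly where \<open>\<langle>\<gamma>', a\<rangle> = 0\<close>
  (\<open>offset_derivative_zero_iff\<close>).

  On the other side, \<open>a\<close> spans the orthogonal complement of the nondegenerate plane spanned by \<open>q\<close>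
  and \<open>q'\<close>, so \<open>\<langle>\<gamma>', a\<rangle> = 0\<close> says that \<open>\<gamma>'\<close> lies in this plane, which is the vanishing of the
  numerator \<open>det (\<gamma>', q, q')\<close> of the distribution parameter (\<open>det_zero_iff_orthogonal_normal\<close>).
  Hence developability means \<open>R' = 0\<close> everywhere, and on an interval this means that \<open>R\<close> is constant.
\<close>

lemma bounded_bilinear_mink: "bounded_bilinear mink"
  unfolding bilinear_conv_bounded_bilinear[symmetric] bilinear_def
  by (auto intro!: linearI simp: mink_def algebra_simps)

interpretation mink: bounded_bilinear mink
  by (rule bounded_bilinear_mink)

lemma mink_commute: "x \<bullet>\<^sub>L y = y \<bullet>\<^sub>L x"
  by (simp add: mink_def mult.commute)

text \<open>In matrix form the right-hand side is the determinant of \<open>X J Y\<^sup>T\<close>, where the rows of \<open>X\<close>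
  and \<open>Y\<close> are the two triples and \<open>J\<close> is the matrix of the metric; the sign is \<open>det J = -1\<close>.\<close>

lemma mink_gram_det:
  "det (vector [x1, x2, x3] :: real^3^3) * det (vector [y1, y2, y3] :: real^3^3) =
   - det (vector [vector [x1 \<bullet>\<^sub>L y1, x1 \<bullet>\<^sub>L y2, x1 \<bullet>\<^sub>L y3],
                  vector [x2 \<bullet>\<^sub>L y1, x2 \<bullet>\<^sub>L y2, x2 \<bullet>\<^sub>L y3],
                  vector [x3 \<bullet>\<^sub>L y1, x3 \<bullet>\<^sub>L y2, x3 \<bullet>\<^sub>L y3]] :: real^3^3)"
  by (simp add: det_3 vector_3 mink_def) algebra

text \<open>With \<open>a\<close> orthogonal to \<open>q\<close> and \<open>p\<close>, the Gram determinant of the triples \<open>(x, q, p)\<close> and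
  \<open>(a, q, p)\<close> is block triangular with corner entry \<open>\<langle>x, a\<rangle>\<close>. The other block is the Gram
  determinant of \<open>q\<close> and \<open>p\<close>, which is negative because the plane contains the spacelike \<open>q\<close> and
  the timelike \<open>p\<close>; taking \<open>x = a\<close> shows that \<open>(a, q, p)\<close> is a basis.\<close>

lemma det_zero_iff_orthogonal_normal:
  assumes q: "q \<bullet>\<^sub>L q > 0" and p: "p \<bullet>\<^sub>L p < 0"
    and a: "a \<bullet>\<^sub>L a \<noteq> 0" and aq: "a \<bullet>\<^sub>L q = 0" and ap: "a \<bullet>\<^sub>L p = 0"
  shows "det (vector [x, q, p] :: real^3^3) = 0 \<longleftrightarrow> x \<bullet>\<^sub>L a = 0"
proof -
  define D where "D = (q \<bullet>\<^sub>L q) * (p \<bullet>\<^sub>L p) - (q \<bullet>\<^sub>L p)\<^sup>2"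
  have "(q \<bullet>\<^sub>L q) * (p \<bullet>\<^sub>L p) < 0"
    using q p by (rule mult_pos_neg)
  then have "D < 0"
    unfolding D_def using zero_le_power2[of "q \<bullet>\<^sub>L p"] by linarith
  have gram: "det (vector [z, q, p] :: real^3^3) * det (vector [a, q, p] :: real^3^3) =
      - ((z \<bullet>\<^sub>L a) * D)" for z
    unfolding mink_gram_det
    using aq ap mink_commute[of q a] mink_commute[of p a] mink_commute[of p q]
    by (simp add: det_3 vector_3 D_def power2_eq_square algebra_simps)
  have "det (vector [a, q, p] :: real^3^3) \<noteq> 0"
    using gram[of a] a \<open>D < 0\<close> by auto
  then show ?thesis
    using gram[of x] \<open>D < 0\<close> by auto
qed

text \<open>The hypothesis fixes \<open>\<langle>f, f\<rangle>\<close> only up to sign, so it is its square that is differentiated.\<close>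

lemma unit_curve_orthogonal_velocity:
  assumes "open I" and "s \<in> I" and unit: "\<And>t. t \<in> I \<Longrightarrow> mink_norm (f t) = 1"
    and f: "(f has_vector_derivative f') (at s)"
  shows "f s \<bullet>\<^sub>L f' = 0"
proof -
  have sq: "(f t \<bullet>\<^sub>L f t)\<^sup>2 = 1" if "t \<in> I" for t
    using unit[OF that] power2_abs[of "f t \<bullet>\<^sub>L f t"] by (simp add: mink_norm_def)
  have "((\<lambda>t. f t \<bullet>\<^sub>L f t) has_vector_derivative (f s \<bullet>\<^sub>L f' + f' \<bullet>\<^sub>L f s)) (at s)"
    by (rule mink.has_vector_derivative[OF f f])
  then have "((\<lambda>t. f t \<bullet>\<^sub>L f t) has_real_derivative 2 * (f s \<bullet>\<^sub>L f')) (at s)"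
    by (simp add: has_real_derivative_iff_has_vector_derivative mink_commute[of f'])
  then have "((\<lambda>t. (f t \<bullet>\<^sub>L f t)\<^sup>2) has_real_derivative
      2 * (f s \<bullet>\<^sub>L f s) * (2 * (f s \<bullet>\<^sub>L f'))) (at s)"
    by (auto intro!: derivative_eq_intros)
  moreover have "((\<lambda>t. (f t \<bullet>\<^sub>L f t)\<^sup>2) has_real_derivative 0) (at s)"
    by (rule has_field_derivative_transform_within_open[of "\<lambda>_. 1" _ _ I])
       (use assms(1,2) sq in auto)
  ultimately have "2 * (f s \<bullet>\<^sub>L f s) * (2 * (f s \<bullet>\<^sub>L f')) = 0"
    by (rule DERIV_unique)
  with sq[OF \<open>s \<in> I\<close>] show ?thesis
    by auto
qed

lemma smooth_curve_on_has_velocity: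
  assumes "smooth_curve_on I f" and "s \<in> I"
  shows "(f has_vector_derivative velocity f s) (at s)"
proof -
  have "((velocity ^^ 0) f) differentiable (at s)"
    using assms unfolding smooth_curve_on_def by blast
  then show ?thesis
    by (simp add: velocity_def vector_derivative_works)
qed

text \<open>Pairing the velocity of \<open>c + R a\<close> with \<open>a\<close> kills the term \<open>R a'\<close>.\<close>

lemma offset_derivative_zero_iff:
  assumes "open I" and "s \<in> I"
    and c: "smooth_curve_on I c" and a: "smooth_curve_on I a" and R: "smooth_curve_on I R"
    and unit: "\<And>t. t \<in> I \<Longrightarrow> mink_norm (a t) = 1"
    and offset: "\<And>t. t \<in> I \<Longrightarrow> c' t = c t + R t *\<^sub>R a t"
    and orth: "velocity c' s \<bullet>\<^sub>L a s = 0"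
  shows "velocity R s = 0 \<longleftrightarrow> velocity c s \<bullet>\<^sub>L a s = 0"
proof -
  note deriv = smooth_curve_on_has_velocity[OF _ \<open>s \<in> I\<close>]
  have "((\<lambda>t. c t + R t *\<^sub>R a t) has_vector_derivative
      velocity c s + (R s *\<^sub>R velocity a s + velocity R s *\<^sub>R a s)) (at s)"
    using deriv[OF R]
    by (intro has_vector_derivative_add has_vector_derivative_scaleR deriv c a)
       (simp add: has_real_derivative_iff_has_vector_derivative)
  then have "(c' has_vector_derivative
      velocity c s + (R s *\<^sub>R velocity a s + velocity R s *\<^sub>R a s)) (at s)"
    by (rule has_vector_derivative_transform_within_open[OF _ \<open>open I\<close> \<open>s \<in> I\<close>])
       (simp add: offset)
  then have "velocity c' s = velocity c s + (R s *\<^sub>R velocity a s + velocity R s *\<^sub>R a s)"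
    unfolding velocity_def[of c'] by (rule vector_derivative_at)
  moreover have "velocity a s \<bullet>\<^sub>L a s = 0"
    using unit_curve_orthogonal_velocity[OF \<open>open I\<close> \<open>s \<in> I\<close> unit deriv[OF a]]
    by (simp add: mink_commute)
  ultimately have "velocity c s \<bullet>\<^sub>L a s + velocity R s * (a s \<bullet>\<^sub>L a s) = 0"
    using orth by (simp add: mink.add_left mink.scaleR_left)
  moreover have "a s \<bullet>\<^sub>L a s \<noteq> 0"
    using unit[OF \<open>s \<in> I\<close>] by (auto simp: mink_norm_def)
  ultimately show ?thesis
    by (auto simp: add_eq_0_iff)
qed

lemma constant_on_iff_velocity_zero:
  fixes f :: "real \<Rightarrow> real"
  assumes "open I" and "is_interval I" and f: "smooth_curve_on I f"
  shows "f constant_on I \<longleftrightarrow> (\<forall>s\<in>I. velocity f s = 0)"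
proof
  assume "f constant_on I"
  then obtain k where k: "\<And>t. t \<in> I \<Longrightarrow> f t = k"
    unfolding constant_on_def by blast
  show "\<forall>s\<in>I. velocity f s = 0"
  proof
    fix s assume "s \<in> I"
    have "(f has_vector_derivative 0) (at s)"
      by (rule has_vector_derivative_transform_within_open[of "\<lambda>_. k" _ _ I])
         (use \<open>open I\<close> \<open>s \<in> I\<close> k in auto)
    then show "velocity f s = 0"
      unfolding velocity_def by (rule vector_derivative_at)
  qed
next
  assume zero: "\<forall>s\<in>I. velocity f s = 0"
  have "(f has_vector_derivative 0) (at s within I)" if "s \<in> I" for s
    using smooth_curve_on_has_velocity[OF f that] zero that
    by (auto intro: has_vector_derivative_at_within)
  then have "\<exists>k. \<forall>s\<in>I. f s = k"
    using has_vector_derivative_zero_constant[of I f] is_interval_convex[OF \<open>is_interval I\<close>]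
    by metis
  then show "f constant_on I"
    unfolding constant_on_def .
qed

lemma parallel_if_same_line:
  assumes "line_through p d = line_through p' d'"
  obtains k where "d = k *\<^sub>R d'"
proof -
  have "p + 0 *\<^sub>R d \<in> line_through p' d'" "p + 1 *\<^sub>R d \<in> line_through p' d'"
    unfolding assms[symmetric] unfolding line_through_def by (rule rangeI)+
  then obtain t u where "p + 0 *\<^sub>R d = p' + t *\<^sub>R d'" "p + 1 *\<^sub>R d = p' + u *\<^sub>R d'"
    unfolding line_through_def by blast
  then have "d = (u - t) *\<^sub>R d'"
    by (simp add: algebra_simps)
  then show thesis
    by (rule that)
qed

lemma ruled_surface_mink_norm_velocity_nonzero:
  assumes "ruled_surface I \<phi> c q" and "s \<in> I"
  shows "mink_norm (velocity q s) \<noteq> 0"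
  using assms by (auto simp: ruled_surface_def null_vector_def mink_norm_def)

theorem theorem4p1:
  fixes I :: "real set"
    and \<phi> \<phi>' :: "real \<Rightarrow> real \<Rightarrow> real^3"
    and c q h a c' q' h' a' :: "real \<Rightarrow> real^3"
    and R :: "real \<Rightarrow> real"
  assumes "open I" and "is_interval I" and "I \<noteq> {}"
    and "ruled_surface I \<phi> c q" and "striction_curve I c q"
    and "frenet_frame I q h a" and "type_N_times I q h"
    and "ruled_surface I \<phi>' c' q'" and "striction_curve I c' q'"
    and "frenet_frame I q' h' a'" and "type_N_minus I q' h' \<or> type_N_plus I q' h'"
    and "mannheim_offset I c a c' h'"
    and "smooth_curve_on I R" and "\<forall>s\<in>I. c' s = c s + R s *\<^sub>R a s"
  shows "developable I c q \<longleftrightarrow> R constant_on I"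
proof -
  have unit: "mink_norm (a t) = 1" if "t \<in> I" for t
    using assms(6) that by (simp add: frenet_frame_def)
  have "distribution_parameter c q s = 0 \<longleftrightarrow> velocity R s = 0" if s: "s \<in> I" for s
  proof -
    \<comment> \<open>\<open>h\<close> and the derivative of the ruling differ by a nonzero factor, so \<open>h\<close> passes its causal
      character and its orthogonality to \<open>a\<close> on to that derivative.\<close>
    let ?m = "mink_norm (velocity q s)"
    have m: "?m \<noteq> 0"
      by (rule ruled_surface_mink_norm_velocity_nonzero[OF assms(4) s])
    have h: "h s = velocity q s /\<^sub>R ?m"
      using assms(6) s by (simp add: frenet_frame_def)
    then have vq: "velocity q s = ?m *\<^sub>R h s"
      using m by simp
    have "h s \<bullet>\<^sub>L h s < 0"
      using assms(7) s by (simp add: type_N_times_def timelike_def)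
    moreover have "velocity q s \<bullet>\<^sub>L velocity q s = ?m\<^sup>2 * (h s \<bullet>\<^sub>L h s)"
      by (subst (1 2) vq) (simp add: mink.scaleR_left mink.scaleR_right power2_eq_square)
    ultimately have p: "velocity q s \<bullet>\<^sub>L velocity q s < 0"
      using m by (simp add: mult_pos_neg)
    have "a s \<bullet>\<^sub>L h s = 0"
      using assms(6) s unfolding frenet_frame_def by blast
    then have ap: "a s \<bullet>\<^sub>L velocity q s = 0"
      by (subst vq) (simp add: mink.scaleR_right)
    have aq: "a s \<bullet>\<^sub>L q s = 0"
      using assms(6) s by (simp add: frenet_frame_def)
    have aa: "a s \<bullet>\<^sub>L a s \<noteq> 0"
      using unit[OF s] by (auto simp: mink_norm_def)
    have "spacelike (q s)"
      using assms(7) s by (simp add: type_N_times_def)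
    moreover have "q s \<bullet>\<^sub>L q s = 1 \<or> q s \<bullet>\<^sub>L q s = -1"
      using assms(4) s by (simp add: ruled_surface_def)
    ultimately have qq: "q s \<bullet>\<^sub>L q s > 0"
      by (auto simp: spacelike_def mink.zero_left)

    \<comment> \<open>The line of \<open>a\<close> is that of \<open>h'\<close>, to which the striction condition makes the velocity of
      \<open>c'\<close> orthogonal.\<close>
    obtain k where k: "a s = k *\<^sub>R h' s"
      using assms(12) s parallel_if_same_line unfolding mannheim_offset_def by metis
    have "h' s = velocity q' s /\<^sub>R mink_norm (velocity q' s)"
      using assms(10) s by (simp add: frenet_frame_def)
    moreover have "velocity c' s \<bullet>\<^sub>L velocity q' s = 0"
      using assms(9) s by (simp add: striction_curve_def)
    ultimately have orth: "velocity c' s \<bullet>\<^sub>L a s = 0"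
      by (simp add: k mink.scaleR_right)

    have "distribution_parameter c q s = 0 \<longleftrightarrow>
        det (vector [velocity c s, q s, velocity q s] :: real^3^3) = 0"
      using p by (simp add: distribution_parameter_def)
    also have "\<dots> \<longleftrightarrow> velocity c s \<bullet>\<^sub>L a s = 0"
      by (rule det_zero_iff_orthogonal_normal[OF qq p aa aq ap])
    also have "\<dots> \<longleftrightarrow> velocity R s = 0"
      by (rule offset_derivative_zero_iff[symmetric, OF \<open>open I\<close> s, of c a R c'])
         (use assms(4,6,13,14) orth in \<open>auto simp: ruled_surface_def frenet_frame_def\<close>)
    finally show ?thesis .
  qed
  then show ?thesis
    by (simp add: developable_def constant_on_iff_velocity_zero[OF assms(1,2,13)])
qed

end
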